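(* Let $G$ be a graph with maximum degree $\Delta=\Delta(G)\ge 1$, let $k\ge\Delta$ be an integer, and let $H$ be the $k$-expanded-clique graph of $G$. Let $S\subseteq V(H)$ contain exactly one vertex of each expanded clique of $H$. Then $S$ is a dominating set of $H$ and $|S|\le\frac{1+\Delta}{\Delta}\,\gamma(H)$.
   Context: All graphs are finite, simple and undirected. Let $G$ be a graph with vertex set $\{v_1,\dots,v_n\}$ and $f:V(G)\to\mathbb{N}$ a function with $f(v_i)\ge d_G(v_i)$ for every $i$. The expanded-clique graph $H$ of $(G,f)$ is the graph (unique up to isomorphism) defined as follows: $V(H)$ is the disjoint union of sets $V_1,\dots,V_n$ (called the expanded cliques of $H$), where $V_i$ has $f(v_i)$ vertices and forms a clique of $H$; for each edge $v_iv_j\in E(G)$ there are vertices $v_{i,j}\in V_i$ and $v_{j,i}\in V_j$ with $v_{i,j}v_{j,i}\in E(H)$, where the vertices $v_{i,j}$ (over all ordered pairs with $v_iv_j\in E(G)$) are pairwise distinct; and $H$ has no other edges. If $f(v_i)=k$ for every $i$, then $H$ is called the $k$-expanded-clique graph of $G$. $\gamma(H)$ is the minimum size of a dominating set of $H$, i.e. of a set $D\subseteq V(H)$ such that every vertex of $V(H)\setminus D$ has a neighbor in $D$. *)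

theory Defs
  imports Complex_Main
begin

(* A graph is given by its vertex set V and its set E of two-element edges {u, v}. *)

definition simple_graph :: "'a set \<Rightarrow> 'a set set \<Rightarrow> bool" where
  "simple_graph V E \<longleftrightarrow> finite V \<and> (\<forall>e\<in>E. e \<subseteq> V \<and> card e = 2)"

definition neighbors :: "'a set set \<Rightarrow> 'a \<Rightarrow> 'a set" where
  "neighbors E v = {u. {v, u} \<in> E}"

definition degree :: "'a set set \<Rightarrow> 'a \<Rightarrow> nat" where
  "degree E v = card (neighbors E v)"

(* The supremum over nat is the maximum for finite nonempty V, and 0 for empty V. *)
definition max_degree :: "'a set \<Rightarrow> 'a set set \<Rightarrow> nat" where
  "max_degree V E = (SUP v\<in>V. degree E v)"

definition dominating_set :: "'a set \<Rightarrow> 'a set set \<Rightarrow> 'a set \<Rightarrow> bool" where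
  "dominating_set V E D \<longleftrightarrow> D \<subseteq> V \<and> (\<forall>x\<in>V - D. neighbors E x \<inter> D \<noteq> {})"

definition domination_number :: "'a set \<Rightarrow> 'a set set \<Rightarrow> nat" where
  "domination_number V E = (LEAST n. \<exists>D. dominating_set V E D \<and> card D = n)"

(* The graph (W, F) is the expanded-clique graph of ((V, E), f), with C v the expanded clique
   of v; p u v is the end vertex in C u of the edge of (W, F) that stems from the edge {u, v}.
   Finiteness of C v is required separately because infinite sets have cardinality 0. *)
definition expanded_clique_graph ::
  "'a set \<Rightarrow> 'a set set \<Rightarrow> ('a \<Rightarrow> nat) \<Rightarrow> 'b set \<Rightarrow> 'b set set \<Rightarrow> ('a \<Rightarrow> 'b set) \<Rightarrow> bool" where
  "expanded_clique_graph V E f W F C \<longleftrightarrow>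
     simple_graph V E \<and>
     (\<forall>v\<in>V. degree E v \<le> f v) \<and>
     (\<forall>v\<in>V. finite (C v) \<and> card (C v) = f v) \<and>
     (\<forall>u\<in>V. \<forall>v\<in>V. u \<noteq> v \<longrightarrow> C u \<inter> C v = {}) \<and>
     W = (\<Union>v\<in>V. C v) \<and>
     (\<exists>p :: 'a \<Rightarrow> 'a \<Rightarrow> 'b.
        (\<forall>u v. {u, v} \<in> E \<longrightarrow> p u v \<in> C u) \<and>
        inj_on (\<lambda>(u, v). p u v) {(u, v). {u, v} \<in> E} \<and>
        F = {{x, y} | x y v. v \<in> V \<and> x \<in> C v \<and> y \<in> C v \<and> x \<noteq> y} \<union>
            {{p u v, p v u} | u v. {u, v} \<in> E})"

definition k_expanded_clique_graph ::
  "'a set \<Rightarrow> 'a set set \<Rightarrow> nat \<Rightarrow> 'b set \<Rightarrow> 'b set set \<Rightarrow> ('a \<Rightarrow> 'b set) \<Rightarrow> bool" where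
  "k_expanded_clique_graph V E k W F C \<longleftrightarrow> expanded_clique_graph V E (\<lambda>_. k) W F C"

lemma expanded_clique_graph_simple:
  assumes "expanded_clique_graph V E f W F C"
  shows "simple_graph W F"
proof -
  obtain p where p: "\<And>u v. {u, v} \<in> E \<Longrightarrow> p u v \<in> C u"
    and F: "F = {{x, y} | x y v. v \<in> V \<and> x \<in> C v \<and> y \<in> C v \<and> x \<noteq> y} \<union>
            {{p u v, p v u} | u v. {u, v} \<in> E}"
    using assms unfolding expanded_clique_graph_def by blast
  have G: "finite V" "\<And>e. e \<in> E \<Longrightarrow> e \<subseteq> V \<and> card e = 2"
    and C: "\<And>v. v \<in> V \<Longrightarrow> finite (C v)"
    and disj: "\<And>u v. u \<in> V \<Longrightarrow> v \<in> V \<Longrightarrow> u \<noteq> v \<Longrightarrow> C u \<inter> C v = {}"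
    and W: "W = (\<Union>v\<in>V. C v)"
    using assms unfolding expanded_clique_graph_def simple_graph_def by auto
  have "{p u v, p v u} \<subseteq> W \<and> card {p u v, p v u} = 2" if e: "{u, v} \<in> E" for u v
  proof -
    have uv: "u \<in> V" "v \<in> V" "u \<noteq> v" using G(2)[OF e] by auto
    have pu: "p u v \<in> C u" "p v u \<in> C v"
      using p[of u v] p[of v u] e by (auto simp: insert_commute)
    then have "p u v \<noteq> p v u" using disj[OF uv] by auto
    then show ?thesis using pu uv W by auto
  qed
  then show ?thesis
    using G(1) C unfolding simple_graph_def F W by auto
qed

end

(* Every clique meeting a dominating set D contains at least one vertex of D.  In a clique avoiding D
   every vertex is an end of an edge stemming from E whose other end lies in D, and these edges form
   a matching.  So if all cliques have at least m vertices and a of them avoid D, then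
   m a <= |D| and n - a <= |D|, hence m n <= (m + 1) |D|. *)
theory Submission
  imports Defs
begin

text \<open>The cliques cover \<open>W\<close>, and a vertex of \<open>S\<close> in a clique is
  adjacent to all other vertices of that clique.\<close>

lemma transversal_dominating:
  assumes H: "expanded_clique_graph V E f W F C"
    and "S \<subseteq> W"
    and S: "\<And>v. v \<in> V \<Longrightarrow> S \<inter> C v \<noteq> {}"
  shows "dominating_set W F S"
  unfolding dominating_set_def
proof (intro conjI ballI)
  show "S \<subseteq> W" by fact
next
  fix x assume x: "x \<in> W - S"
  then obtain v where v: "v \<in> V" "x \<in> C v"
    using H unfolding expanded_clique_graph_def by blast
  obtain s where s: "s \<in> S" "s \<in> C v" using S[OF v(1)] by blast
  moreover have "x \<noteq> s" using x s by blast
  ultimately have "{x, s} \<in> F"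
    using H v unfolding expanded_clique_graph_def by blast
  then show "neighbors F x \<inter> S \<noteq> {}" using s by (auto simp: neighbors_def)
qed

text \<open>Sending a clique to its vertex in \<open>S\<close> is a bijection from \<open>V\<close>
  to \<open>S\<close>: injective because the cliques are disjoint, onto because they cover
  \<open>W\<close>.\<close>

lemma card_transversal:
  assumes H: "expanded_clique_graph V E f W F C"
    and "S \<subseteq> W"
    and S: "\<And>v. v \<in> V \<Longrightarrow> \<exists>!x. x \<in> S \<inter> C v"
  shows "card S = card V"
proof -
  define s where "s v = (THE x. x \<in> S \<inter> C v)" for v
  have s: "s v \<in> S \<inter> C v" if "v \<in> V" for v
    unfolding s_def by (rule theI'[OF S[OF that]])
  have disj: "\<And>u v. u \<in> V \<Longrightarrow> v \<in> V \<Longrightarrow> u \<noteq> v \<Longrightarrow> C u \<inter> C v = {}"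
    and W: "W = (\<Union>v\<in>V. C v)"
    using H unfolding expanded_clique_graph_def by blast+
  have "inj_on s V"
  proof (rule inj_onI)
    fix u v assume "u \<in> V" "v \<in> V" "s u = s v"
    then show "u = v" using s[of u] s[of v] disj[of u v] by auto
  qed
  moreover have "s ` V = S"
  proof
    show "s ` V \<subseteq> S" using s by blast
    show "S \<subseteq> s ` V"
    proof
      fix x assume x: "x \<in> S"
      then obtain v where v: "v \<in> V" "x \<in> C v"
        using W \<open>S \<subseteq> W\<close> by blast
      then have "x = s v" using S[OF v(1)] s[OF v(1)] x by blast
      then show "x \<in> s ` V" using v by blast
    qed
  qed
  ultimately show ?thesis using card_image by blast
qed

text \<open>The product form avoids division, so \<open>m = 0\<close> needs no separate treatment.
  Only a lower bound on the clique sizes enters, which lets the theorem take the maximum degree for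
  \<open>m\<close> although the cliques have size \<open>k\<close>.\<close>

lemma dominating_set_card_bound:
  assumes H: "expanded_clique_graph V E f W F C"
    and m: "\<And>v. v \<in> V \<Longrightarrow> m \<le> f v"
    and D: "dominating_set W F D"
  shows "m * card V \<le> (m + 1) * card D"
proof -
  obtain p where
    inj: "inj_on (\<lambda>(u, v). p u v) {(u, v). {u, v} \<in> E}"
    and F: "F = {{x, y} | x y v. v \<in> V \<and> x \<in> C v \<and> y \<in> C v \<and> x \<noteq> y} \<union>
            {{p u v, p v u} | u v. {u, v} \<in> E}"
    using H unfolding expanded_clique_graph_def by blast
  have V: "finite V"
    and C: "\<And>v. v \<in> V \<Longrightarrow> finite (C v) \<and> card (C v) = f v"
    and disj: "\<And>u v. u \<in> V \<Longrightarrow> v \<in> V \<Longrightarrow> u \<noteq> v \<Longrightarrow> C u \<inter> C v = {}"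
    and W: "W = (\<Union>v\<in>V. C v)"
    using H unfolding expanded_clique_graph_def simple_graph_def by blast+
  have DW: "D \<subseteq> W" using D unfolding dominating_set_def by blast
  have finD: "finite D" using DW W V C finite_subset by (metis finite_UN)
  define A where "A = {v \<in> V. C v \<inter> D = {}}"
  define U where "U = (\<Union>v\<in>A. C v)"
  have A: "A \<subseteq> V" "finite A" using V by (auto simp: A_def)

  have "\<exists>y u w. y \<in> D \<and> {u, w} \<in> E \<and> x = p u w \<and> y = p w u" if x: "x \<in> U" for x
  proof -
    obtain v where v: "v \<in> V" "C v \<inter> D = {}" "x \<in> C v"
      using x unfolding U_def A_def by blast
    then have "x \<in> W - D" using W by blast
    then obtain y where y: "y \<in> D" "{x, y} \<in> F"
      using D unfolding dominating_set_def neighbors_def by blast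
    \<comment> \<open>By disjointness \<open>x\<close> lies in no clique but \<open>C v\<close>, and
      \<open>C v\<close> avoids \<open>D\<close>, so \<open>y\<close> lies elsewhere. The edge that
      dominates \<open>x\<close> therefore stems from \<open>E\<close>.\<close>
    have "\<not> (v' \<in> V \<and> x \<in> C v' \<and> y \<in> C v')" for v'
      using v y(1) disj by blast
    then have "{x, y} \<notin> {{x, y} | x y v. v \<in> V \<and> x \<in> C v \<and> y \<in> C v \<and> x \<noteq> y}"
      by (auto simp: doubleton_eq_iff)
    then obtain u w where uw: "{u, w} \<in> E" "{x, y} = {p u w, p w u}"
      using y(2) unfolding F by blast
    \<comment> \<open>The equality of unordered pairs does not tell which end is \<open>x\<close>;
      if it is \<open>p w u\<close>, the roles of \<open>u\<close> and \<open>w\<close> are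
      exchanged.\<close>
    moreover have "{w, u} \<in> E" using uw(1) by (simp add: insert_commute)
    ultimately show ?thesis using y(1) unfolding doubleton_eq_iff by blast
  qed
  then obtain g where g: "\<And>x. x \<in> U \<Longrightarrow>
      \<exists>u w. g x \<in> D \<and> {u, w} \<in> E \<and> x = p u w \<and> g x = p w u" by metis
  have "inj_on g U"
  proof (rule inj_onI)
    fix x x' assume x: "x \<in> U" "x' \<in> U" and eq: "g x = g x'"
    obtain u w where 1: "{w, u} \<in> E" "x = p u w" "g x = p w u"
      using g[OF x(1)] by (metis insert_commute)
    obtain u' w' where 2: "{w', u'} \<in> E" "x' = p u' w'" "g x' = p w' u'"
      using g[OF x(2)] by (metis insert_commute)
    \<comment> \<open>The matching property: by injectivity of \<open>p\<close>, the common end in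
      \<open>D\<close> determines its ordered pair of indices, and this pair determines the opposite
      end.\<close>
    have "(w, u) = (w', u')"
      by (rule inj_onD[OF inj]) (use 1 2 eq in auto)
    then show "x = x'" using 1 2 by simp
  qed
  moreover have "g ` U \<subseteq> D" using g by blast
  ultimately have "card U \<le> card D" using finD card_inj_on_le by blast
  moreover have "card U = (\<Sum>v\<in>A. card (C v))"
    unfolding U_def using A C disj by (intro card_UN_disjoint) blast+
  \<comment> \<open>Each of the \<open>card A\<close> disjoint cliques that make up \<open>U\<close>
    contributes at least \<open>m\<close> vertices.\<close>
  moreover have "(\<Sum>v\<in>A. m) \<le> (\<Sum>v\<in>A. card (C v))"
    by (rule sum_mono) (use A C m in force)
  ultimately have avoiding: "m * card A \<le> card D" by (simp add: mult.commute)

  have "\<forall>v\<in>V - A. \<exists>x. x \<in> C v \<inter> D" by (auto simp: A_def)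
  \<comment> \<open>Distinct cliques receive distinct vertices of \<open>D\<close>, since cliques
    are disjoint.\<close>
  then obtain h where h: "\<And>v. v \<in> V - A \<Longrightarrow> h v \<in> C v \<inter> D" by metis
  have "inj_on h (V - A)"
  proof (rule inj_onI)
    fix u v assume "u \<in> V - A" "v \<in> V - A" "h u = h v"
    then show "u = v" using h[of u] h[of v] disj[of u v] by auto
  qed
  moreover have "h ` (V - A) \<subseteq> D" using h by blast
  ultimately have meeting: "card (V - A) \<le> card D" using finD card_inj_on_le by blast

  have "card V = card A + card (V - A)"
    using A V by (simp add: card_Diff_subset card_mono)
  then have "m * card V = m * card A + m * card (V - A)" by (simp add: algebra_simps)
  also have "\<dots> \<le> card D + m * card D"
    using avoiding meeting by (intro add_mono mult_le_mono2)
  finally show ?thesis by simp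
qed

text \<open>\<open>LEAST\<close> is a genuine minimum once some dominating set exists; in the
  theorem \<open>S\<close> itself is the witness.\<close>

lemma domination_number_attained:
  assumes "dominating_set V E S"
  obtains D where "dominating_set V E D" "card D = domination_number V E"
proof -
  have "\<exists>D. dominating_set V E D \<and> card D = domination_number V E"
    unfolding domination_number_def by (rule LeastI_ex) (use assms in blast)
  then show ?thesis using that by blast
qed

theorem mainTheorem10:
  fixes V :: "'a set" and E :: "'a set set"
    and W :: "'b set" and F :: "'b set set"
    and C :: "'a \<Rightarrow> 'b set" and k :: nat and S :: "'b set"
  assumes "simple_graph V E"
    and "max_degree V E \<ge> 1"
    and "k \<ge> max_degree V E"
    and "k_expanded_clique_graph V E k W F C"
    and "S \<subseteq> W"
    and "\<forall>v\<in>V. \<exists>!x. x \<in> S \<inter> C v"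
  shows "dominating_set W F S \<and>
    real (card S) \<le> (1 + real (max_degree V E)) / real (max_degree V E) * real (domination_number W F)"
proof
  have H: "expanded_clique_graph V E (\<lambda>_. k) W F C"
    using assms(4) unfolding k_expanded_clique_graph_def .
  show dom: "dominating_set W F S"
    by (rule transversal_dominating[OF H assms(5)]) (use bspec[OF assms(6)] in blast)
  obtain D where D: "dominating_set W F D" "card D = domination_number W F"
    using domination_number_attained[OF dom] .
  have "card S = card V"
    by (rule card_transversal[OF H assms(5) bspec[OF assms(6)]])
  \<comment> \<open>Here \<open>m\<close> is the maximum degree, a lower bound for the common clique
    size \<open>k\<close>. Being at least 1, it can be divided by at the end.\<close>
  then have "max_degree V E * card S \<le> (max_degree V E + 1) * domination_number W F"
    using dominating_set_card_bound[OF H assms(3) D(1)] D(2) by simp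
  then have "real (max_degree V E * card S)
      \<le> real ((max_degree V E + 1) * domination_number W F)"
    by (rule of_nat_mono)
  then show "real (card S) \<le>
      (1 + real (max_degree V E)) / real (max_degree V E) * real (domination_number W F)"
    using assms(2) by (simp add: field_simps)
qed

end
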